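(* Let $M$ be a matroid of rank $r\ge 1$ on $n$ elements with no loops. Then $$T(M;x,y)=T(U_{r,n};x,y)+(xy-x-y)\sum_{k=1}^{r-1}\ \sum_{m=k}^{n}\ \sum_{t=0}^{r-k-1}f^{t}_{k,m}\,(x-1)^{r-k-t-1}\,\tau(k+1+t,\,m-k-t-1;\,y).$$
   Context: The Tutte polynomial of a rank-$r$ matroid on $S$ is $T(M;x,y)=\sum_{A\subseteq S}(x-1)^{r-\mathrm{rk}(A)}(y-1)^{|A|-\mathrm{rk}(A)}$. $U_{r,n}$ is the uniform matroid of rank $r$ on $n$ elements. The Möbius invariant of a matroid $N$ is $\mu(N)=T(N;1,0)$ (for loopless $N$ this is the absolute value of the Möbius function of the lattice of flats of $N$ evaluated from bottom to top). $\mathrm{Trun}^{s}$ denotes $s$-fold truncation; each truncation lowers the rank by one, keeping the flats of all ranks except those of corank $1$. The flat numbers of $M$ are, for $k\le m$ and $0\le t\le r-k-1$, $$f^{t}_{k,m}=(-1)^t\sum_{X}\mu(\mathrm{Trun}^{r-k-t-1}(M/X)),$$ where the sum is over all flats $X$ of $M$ with $\mathrm{rk}(X)=k$ and $|X|=m$. Here $\mathrm{Trun}^{r-k-t-1}(M/X)$ has rank $t+1$; in particular, $f^0_{k,m}$ is the number of flats of rank $k$ and size $m$. For $d\ge1$, $\alpha\ge0$: $\tau(d,\alpha;y)=\sum_{i=0}^{\alpha}\binom{\alpha+d-1-i}{\alpha-i}y^i$; and $\tau(d,\alpha;y)=0$ if $d\le 0$ or $\alpha<0$. *)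

theory Defs
  imports Complex_Main
begin

section \<open>Matroids, given by their rank functions\<close>

record 'a rank_system =
  ground :: "'a set"
  rk :: "'a set \<Rightarrow> nat"

text \<open>Whitney's rank axioms. Only the values of \<open>rk\<close> on subsets of the ground set matter.\<close>

locale matroid =
  fixes M :: "'a rank_system"
  assumes finite_ground: "finite (ground M)"
    and rk_le_card: "A \<subseteq> ground M \<Longrightarrow> rk M A \<le> card A"
    and rk_mono: "A \<subseteq> B \<Longrightarrow> B \<subseteq> ground M \<Longrightarrow> rk M A \<le> rk M B"
    and rk_submodular: "A \<subseteq> ground M \<Longrightarrow> B \<subseteq> ground M \<Longrightarrow>
          rk M (A \<union> B) + rk M (A \<inter> B) \<le> rk M A + rk M B"

definition rank :: "'a rank_system \<Rightarrow> nat" where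
  "rank M = rk M (ground M)"

definition loopless :: "'a rank_system \<Rightarrow> bool" where
  "loopless M \<longleftrightarrow> (\<forall>e\<in>ground M. rk M {e} \<noteq> 0)"

definition flats :: "'a rank_system \<Rightarrow> 'a set set" where
  "flats M = {X. X \<subseteq> ground M \<and> (\<forall>e\<in>ground M - X. rk M X < rk M (insert e X))}"

definition uniform :: "nat \<Rightarrow> nat \<Rightarrow> nat rank_system" where
  "uniform r n = \<lparr>ground = {..<n}, rk = (\<lambda>A. min (card A) r)\<rparr>"

definition contraction :: "'a rank_system \<Rightarrow> 'a set \<Rightarrow> 'a rank_system" where
  "contraction M X = \<lparr>ground = ground M - X, rk = (\<lambda>A. rk M (A \<union> X) - rk M X)\<rparr>"

text \<open>A single truncation; \<open>s\<close>-fold truncation is \<open>truncation ^^ s\<close>.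
  See \<open>flats_truncation\<close> below for its effect on flats.\<close>

definition truncation :: "'a rank_system \<Rightarrow> 'a rank_system" where
  "truncation M = \<lparr>ground = ground M, rk = (\<lambda>A. min (rk M A) (rank M - 1))\<rparr>"

section \<open>Tutte polynomial, Moebius invariant, flat numbers\<close>

text \<open>The Tutte polynomial is given by its values on an arbitrary commutative ring, so an
  identity for all \<open>x y :: 'b::comm_ring_1\<close> includes the identity of
  polynomials over the integers: take \<open>'b = int poly poly\<close> and the two indeterminates.\<close>

definition tutte :: "'a rank_system \<Rightarrow> 'b::comm_ring_1 \<Rightarrow> 'b \<Rightarrow> 'b" where
  "tutte M x y =
     (\<Sum>A\<in>Pow (ground M). (x - 1) ^ (rank M - rk M A) * (y - 1) ^ (card A - rk M A))"

definition moebius_inv :: "'a rank_system \<Rightarrow> int" where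
  "moebius_inv N = tutte N 1 0"

text \<open>Meaningful for \<open>k \<le> m\<close> and \<open>t \<le> rank M - k - 1\<close> with \<open>k < rank M\<close>, where none of the
  natural-number subtractions truncates.\<close>

definition flat_number :: "'a rank_system \<Rightarrow> nat \<Rightarrow> nat \<Rightarrow> nat \<Rightarrow> int" where
  "flat_number M t k m =
     (-1) ^ t * (\<Sum>X | X \<in> flats M \<and> rk M X = k \<and> card X = m.
        moebius_inv ((truncation ^^ (rank M - k - t - 1)) (contraction M X)))"

text \<open>The parameters are integers because the second one can be negative.\<close>

definition tau :: "int \<Rightarrow> int \<Rightarrow> 'b::comm_ring_1 \<Rightarrow> 'b" where
  "tau d \<alpha> y =
     (if d \<le> 0 \<or> \<alpha> < 0 then 0
      else \<Sum>i=0..nat \<alpha>. of_nat (nat (\<alpha> + d - 1 - int i) choose nat (\<alpha> - int i)) * y ^ i)"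

section \<open>Basic facts\<close>

lemma min_submodular:
  fixes a b i u q :: nat
  assumes "u + i \<le> a + b" "a \<le> u" "b \<le> u"
  shows "min u q + min i q \<le> min a q + min b q"
proof (cases "q \<le> a \<or> q \<le> b")
  case True
  have "i \<le> a" "i \<le> b" using assms by linarith+
  then have "min i q \<le> min a q" "min i q \<le> min b q"
    by (simp_all add: min.coboundedI1)
  moreover have "min a q = q \<or> min b q = q" "min u q = q"
    using True assms(2,3) by (auto simp: min_def)
  ultimately show ?thesis by linarith
next
  case False
  then have "min a q = a" "min b q = b" by simp_all
  then show ?thesis
    using assms(1) by (metis add_mono min.cobounded1 order_trans)
qed

lemma matroid_uniform: "matroid (uniform r n)"
proof
  fix A B :: "nat set"
  assume AB: "A \<subseteq> ground (uniform r n)" "B \<subseteq> ground (uniform r n)"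
  then have fin: "finite A" "finite B"
    by (simp_all add: uniform_def finite_subset[OF _ finite_lessThan])
  then have "card A + card B = card (A \<union> B) + card (A \<inter> B)"
    by (rule card_Un_Int)
  moreover have "card A \<le> card (A \<union> B)" "card B \<le> card (A \<union> B)"
    using fin by (auto intro: card_mono)
  ultimately show "rk (uniform r n) (A \<union> B) + rk (uniform r n) (A \<inter> B)
      \<le> rk (uniform r n) A + rk (uniform r n) B"
    by (simp add: uniform_def min_submodular)
next
  fix A B :: "nat set"
  assume "A \<subseteq> B" "B \<subseteq> ground (uniform r n)"
  then have "card A \<le> card B"
    by (simp add: uniform_def card_mono finite_subset[OF _ finite_lessThan])
  then show "rk (uniform r n) A \<le> rk (uniform r n) B"
    by (simp add: uniform_def min.coboundedI1)
qed (auto simp: uniform_def)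

lemma rank_uniform: "r \<le> n \<Longrightarrow> rank (uniform r n) = r"
  by (simp add: rank_def uniform_def)

context matroid
begin

lemma rk_le_rank: "A \<subseteq> ground M \<Longrightarrow> rk M A \<le> rank M"
  by (simp add: rank_def rk_mono)

lemma matroid_truncation: "matroid (truncation M)"
proof
  fix A B :: "'a set"
  assume "A \<subseteq> ground (truncation M)" "B \<subseteq> ground (truncation M)"
  then have AB: "A \<subseteq> ground M" "B \<subseteq> ground M"
    by (auto simp: truncation_def)
  have "rk M A \<le> rk M (A \<union> B)" "rk M B \<le> rk M (A \<union> B)"
    using AB by (auto intro: rk_mono)
  then show "rk (truncation M) (A \<union> B) + rk (truncation M) (A \<inter> B)
      \<le> rk (truncation M) A + rk (truncation M) B"
    using rk_submodular[OF AB] by (simp add: truncation_def min_submodular)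
next
  fix A B :: "'a set"
  assume "A \<subseteq> B" "B \<subseteq> ground (truncation M)"
  then show "rk (truncation M) A \<le> rk (truncation M) B"
    using rk_mono[of A B] by (simp add: truncation_def min.coboundedI1)
qed (simp_all add: truncation_def finite_ground rk_le_card min.coboundedI1)

lemma rank_truncation: "rank (truncation M) = rank M - 1"
  by (simp add: truncation_def rank_def)

lemma flats_truncation:
  assumes "rank M \<ge> 1"
  shows "flats (truncation M) = {X \<in> flats M. rk M X \<noteq> rank M - 1}"
proof (intro set_eqI iffI)
  fix X
  assume X: "X \<in> flats (truncation M)"
  then have sub: "X \<subseteq> ground M"
    by (simp add: flats_def truncation_def)
  have lt: "rk M X < rk M (insert e X) \<and> rk M X < rank M - 1" if "e \<in> ground M - X" for e
    using X that by (auto simp: flats_def truncation_def min_def split: if_splits)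
  have "rk M X \<noteq> rank M - 1"
  proof (cases "X = ground M")
    case True
    then show ?thesis using assms by (simp add: rank_def)
  next
    case False
    then obtain e where "e \<in> ground M - X" using sub by auto
    from lt[OF this] show ?thesis by simp
  qed
  moreover have "X \<in> flats M"
    using sub lt by (simp add: flats_def)
  ultimately show "X \<in> {X \<in> flats M. rk M X \<noteq> rank M - 1}"
    by blast
next
  fix X
  assume X: "X \<in> {X \<in> flats M. rk M X \<noteq> rank M - 1}"
  then have sub: "X \<subseteq> ground M"
    by (simp add: flats_def)
  have "min (rk M X) (rank M - 1) < min (rk M (insert e X)) (rank M - 1)"
    if e: "e \<in> ground M - X" for e
  proof -
    have "rk M X < rk M (insert e X)"
      using X e by (simp add: flats_def)
    moreover have "rk M (insert e X) \<le> rank M"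
      using sub e by (intro rk_le_rank) auto
    ultimately show ?thesis using X by auto
  qed
  then show "X \<in> flats (truncation M)"
    using sub by (simp add: flats_def truncation_def)
qed

lemma matroid_contraction:
  assumes "X \<subseteq> ground M"
  shows "matroid (contraction M X)"
proof
  fix A B :: "'a set"
  assume "A \<subseteq> ground (contraction M X)" "B \<subseteq> ground (contraction M X)"
  then have AB: "A \<union> X \<subseteq> ground M" "B \<union> X \<subseteq> ground M" "A \<inter> B \<union> X \<subseteq> ground M"
    using assms by (auto simp: contraction_def)
  have eq: "(A \<union> X) \<union> (B \<union> X) = A \<union> B \<union> X" "(A \<union> X) \<inter> (B \<union> X) = A \<inter> B \<union> X"
    by auto
  have "rk M X \<le> rk M (A \<inter> B \<union> X)" "rk M (A \<inter> B \<union> X) \<le> rk M (A \<union> X)"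
    "rk M (A \<inter> B \<union> X) \<le> rk M (B \<union> X)" "rk M (A \<union> X) \<le> rk M (A \<union> B \<union> X)"
    using AB by (auto intro!: rk_mono)
  then have "(rk M (A \<union> B \<union> X) - rk M X) + (rk M (A \<inter> B \<union> X) - rk M X)
      \<le> (rk M (A \<union> X) - rk M X) + (rk M (B \<union> X) - rk M X)"
    using rk_submodular[OF AB(1,2)] unfolding eq by linarith
  then show "rk (contraction M X) (A \<union> B) + rk (contraction M X) (A \<inter> B)
      \<le> rk (contraction M X) A + rk (contraction M X) B"
    by (simp only: contraction_def rank_system.simps)
next
  fix A B :: "'a set"
  assume "A \<subseteq> B" "B \<subseteq> ground (contraction M X)"
  then have "A \<union> X \<subseteq> B \<union> X" "B \<union> X \<subseteq> ground M"
    using assms by (auto simp: contraction_def)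
  then have "rk M (A \<union> X) \<le> rk M (B \<union> X)"
    by (rule rk_mono)
  then show "rk (contraction M X) A \<le> rk (contraction M X) B"
    by (simp add: contraction_def diff_le_mono)
next
  fix A :: "'a set"
  assume "A \<subseteq> ground (contraction M X)"
  then have A: "A \<subseteq> ground M"
    by (auto simp: contraction_def)
  then show "rk (contraction M X) A \<le> card A"
    using rk_submodular[OF A assms] rk_le_card[OF A] by (simp add: contraction_def)
qed (simp add: contraction_def finite_ground)

lemma rank_contraction: "X \<subseteq> ground M \<Longrightarrow> rank (contraction M X) = rank M - rk M X"
  by (simp add: contraction_def rank_def Un_absorb2)

end

end

theory Submission
  imports Defs
begin

text \<open>Write \<open>u = x - 1\<close>, \<open>v = y - 1\<close>, so that \<open>xy - x - y = uv - 1\<close>. Pairing the subsets of the two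
  ground sets by size and telescoping, \<open>T(M) - T(U)\<close> is \<open>uv - 1\<close> times the sum over \<open>s < r\<close> of
  \<open>u^(r-1-s)\<close> times the sum of \<open>v^(|A|-1-s)\<close> over the sets \<open>A\<close> with \<open>rk A \<le> s < |A|\<close>.
  On the other hand \<open>\<tau>(s+1, m-s-1; y)\<close> is the sum of \<open>v^(|B|-1-s)\<close> over the subsets \<open>B\<close> of an
  \<open>m\<close>-set with \<open>|B| > s\<close>, and the signed Moebius invariant attached to a flat \<open>X\<close> with
  \<open>s = rk X + t\<close> is \<open>c(X)\<close>, the sum of \<open>(-1)^|Y - X|\<close> over all \<open>Y \<supseteq> X\<close> of rank at most \<open>s\<close>.
  The same \<open>c(X)\<close> vanishes when \<open>X\<close> is not a flat, so Moebius inversion in the Boolean lattice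
  shows that the \<open>c(X)\<close> with \<open>X \<supseteq> A\<close> add up to \<open>1\<close> if \<open>rk A \<le> s\<close>, and to \<open>0\<close> otherwise.\<close>

section \<open>Signed sums over Boolean lattices\<close>

lemma sum_Pow_insert:
  assumes "finite X" and "e \<notin> X"
  shows "sum f (Pow (insert e X)) = (\<Sum>B\<in>Pow X. f B + f (insert e B))"
proof -
  have "inj_on (insert e) (Pow X)"
    using assms(2) by (auto simp: inj_on_def)
  moreover have "Pow X \<inter> insert e ` Pow X = {}"
    using assms(2) by auto
  ultimately show ?thesis
    using assms(1) by (simp add: Pow_insert sum.union_disjoint sum.reindex sum.distrib)
qed

text \<open>Adding or removing \<open>e\<close> is a sign-reversing involution without fixed points.
  It serves three times: for Boolean inversion, for the vanishing at non-flats, and for the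
  alternating sum over the complement of a flat.\<close>

lemma sum_Pow_eq_0_toggle:
  fixes f :: "'a set \<Rightarrow> 'b::ab_group_add"
  assumes "finite E" and "e \<in> E"
    and "\<And>B. B \<subseteq> E - {e} \<Longrightarrow> f (insert e B) = - f B"
  shows "sum f (Pow E) = 0"
proof -
  have "sum f (Pow E) = (\<Sum>B\<in>Pow (E - {e}). f B + f (insert e B))"
    using sum_Pow_insert[of "E - {e}" e f] assms(1,2) by (simp add: insert_absorb)
  also have "\<dots> = 0"
    using assms(3) by (intro sum.neutral) auto
  finally show ?thesis .
qed

text \<open>Toggling an element of \<open>Y - A\<close> flips the sign and keeps \<open>X\<close> in
  the interval from \<open>A\<close> to \<open>Y\<close>. This is the delta relation behind Moebius
  inversion over subsets.\<close>

lemma sum_interval_alternating: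
  assumes "finite Y" and "A \<subseteq> Y"
  shows "(\<Sum>X\<in>Pow Y. if A \<subseteq> X then (-1) ^ card (Y - X) else 0) = (if Y = A then 1 else (0::int))"
proof (cases "Y = A")
  case True
  have "(\<Sum>X\<in>Pow Y. if A \<subseteq> X then (-1) ^ card (Y - X) else (0::int)) =
    (\<Sum>X\<in>Pow Y. if X = Y then 1 else 0)"
    using True by (intro sum.cong) auto
  then show ?thesis using assms(1) True by simp
next
  case False
  then obtain e where e: "e \<in> Y" "e \<notin> A" using assms(2) by auto
  have "(\<Sum>X\<in>Pow Y. if A \<subseteq> X then (-1) ^ card (Y - X) else (0::int)) = 0"
  proof (rule sum_Pow_eq_0_toggle[OF assms(1) e(1)])
    fix B assume B: "B \<subseteq> Y - {e}"
    have "Y - B = insert e (Y - insert e B)"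
      using B e by auto
    then have "card (Y - B) = Suc (card (Y - insert e B))"
      using assms(1) by (metis Diff_iff card_insert_disjoint finite_Diff insertI1)
    moreover have "A \<subseteq> insert e B \<longleftrightarrow> A \<subseteq> B" using e by auto
    ultimately show "(if A \<subseteq> insert e B then (-1) ^ card (Y - insert e B) else (0::int)) =
      - (if A \<subseteq> B then (-1) ^ card (Y - B) else 0)"
      by simp
  qed
  then show ?thesis using False by simp
qed

section \<open>The polynomials tau as sums over subsets\<close>

text \<open>The guard keeps truncated subtraction from giving small sets the weight
  \<open>(y - 1)^0 = 1\<close>.\<close>

definition large_weight :: "nat \<Rightarrow> 'b::comm_ring_1 \<Rightarrow> 'a set \<Rightarrow> 'b" where
  "large_weight s y B = (if s < card B then (y - 1) ^ (card B - 1 - s) else 0)"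

text \<open>Binomial symmetry turns the lower index into \<open>s\<close>. The range can then grow
  to all \<open>i < m\<close>, because the extra binomials vanish; this also absorbs the default
  value 0 of \<open>tau\<close> when \<open>s \<ge> m\<close>. In this form a recursion in
  \<open>m\<close> is a mere index shift.\<close>

lemma tau_eq_sum_lessThan:
  "tau (int s + 1) (int m - int s - 1) y = (\<Sum>i<m. of_nat ((m - 1 - i) choose s) * y ^ i)"
proof (cases "s < m")
  case False
  then have "(\<Sum>i<m. of_nat ((m - 1 - i) choose s) * y ^ i) = 0"
    by (intro sum.neutral) (auto simp: binomial_eq_0)
  then show ?thesis using False by (simp add: tau_def)
next
  case True
  have "tau (int s + 1) (int m - int s - 1) y =
    (\<Sum>i=0..m-s-1. of_nat ((m - 1 - i) choose (m - s - 1 - i)) * y ^ i)"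
    unfolding tau_def using True
    by (auto intro!: sum.cong arg_cong2[where f = "(*)"] arg_cong[where f = of_nat]
        arg_cong2[where f = binomial])
  also have "\<dots> = (\<Sum>i=0..m-s-1. of_nat ((m - 1 - i) choose s) * y ^ i)"
  proof (intro sum.cong refl)
    fix i assume "i \<in> {0..m-s-1}"
    then have "(m - 1 - i) - s = m - s - 1 - i" "s \<le> m - 1 - i" using True by auto
    then show "of_nat ((m - 1 - i) choose (m - s - 1 - i)) * y ^ i =
      of_nat ((m - 1 - i) choose s) * y ^ i"
      using binomial_symmetric[of s "m - 1 - i"] by simp
  qed
  also have "\<dots> = (\<Sum>i<m. of_nat ((m - 1 - i) choose s) * y ^ i)"
  proof (rule sum.mono_neutral_left)
    show "\<forall>i\<in>{..<m} - {0..m-s-1}. of_nat ((m - 1 - i) choose s) * y ^ i = 0"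
    proof
      fix i assume "i \<in> {..<m} - {0..m-s-1}"
      then have "m - 1 - i < s" by auto
      then show "of_nat ((m - 1 - i) choose s) * y ^ i = 0" by (simp only: binomial_eq_0) simp
    qed
  qed (use True in auto)
  finally show ?thesis .
qed

lemma tau_Suc:
  "tau (int s + 1) (int (Suc m) - int s - 1) y =
     of_nat (m choose s) + y * tau (int s + 1) (int m - int s - 1) y"
  unfolding tau_eq_sum_lessThan sum.lessThan_Suc_shift
  by (simp add: sum_distrib_left mult_ac)

text \<open>Adding one element to \<open>X\<close> makes the subset sum obey the recursion
  \<open>tau_Suc\<close>, whose binomial counts the subsets of size \<open>s\<close>.\<close>

lemma tau_eq_sum_large_weight:
  assumes "finite X"
  shows "tau (int s + 1) (int (card X) - int s - 1) y = (\<Sum>B\<in>Pow X. large_weight s y B)"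
  using assms
proof (induction X rule: finite_induct)
  case empty
  show ?case by (simp add: tau_def large_weight_def)
next
  case (insert e X)
  \<comment> \<open>With \<open>v = y - 1\<close>, a large \<open>B\<close> gives
    \<open>v^j + v^(j+1) = y * v^j\<close>. If \<open>card B = s\<close>, only
    \<open>insert e B\<close> is large, with weight \<open>v^0 = 1\<close>.\<close>
  have step: "large_weight s y B + large_weight s y (insert e B) =
      (if card B = s then 1 else 0) + y * large_weight s y B" if "B \<in> Pow X" for B
  proof -
    have "card (insert e B) = Suc (card B)"
      using that insert.hyps finite_subset by (intro card_insert_disjoint) auto
    then show ?thesis
    proof (cases "s < card B")
      case True
      then have "card B - s = Suc (card B - 1 - s)" by simp
      then show ?thesis using True \<open>card (insert e B) = Suc (card B)\<close>
        by (simp add: large_weight_def algebra_simps)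
    qed (auto simp: large_weight_def)
  qed
  have "(\<Sum>B\<in>Pow X. if card B = s then 1 else 0) = of_nat (card {B. B \<subseteq> X \<and> card B = s})"
    using insert.hyps(1) by (simp add: sum.If_cases Int_def)
  also have "\<dots> = of_nat (card X choose s)"
    using insert.hyps(1) by (simp add: n_subsets)
  finally have count: "(\<Sum>B\<in>Pow X. if card B = s then 1 else 0) = of_nat (card X choose s)" .
  have "(\<Sum>B\<in>Pow (insert e X). large_weight s y B) =
    (\<Sum>B\<in>Pow X. (if card B = s then 1 else 0) + y * large_weight s y B)"
    unfolding sum_Pow_insert[OF insert.hyps] using step by (intro sum.cong) auto
  also have "\<dots> = of_nat (card X choose s) + y * (\<Sum>B\<in>Pow X. large_weight s y B)"
    by (simp add: sum.distrib sum_distrib_left count)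
  also have "\<dots> = tau (int s + 1) (int (Suc (card X)) - int s - 1) y"
    unfolding tau_Suc insert.IH ..
  also have "Suc (card X) = card (insert e X)" using insert.hyps by simp
  finally show ?case by simp
qed

section \<open>Signed Moebius invariants of truncated contractions\<close>

lemma ground_truncation_pow: "ground ((truncation ^^ q) N) = ground N"
  by (induction q) (simp_all add: truncation_def)

text \<open>The induction carries both claims, since the rank function of one more truncation refers
  to the current rank.\<close>

lemma rk_truncation_pow:
  assumes "rk N A \<le> rank N"
  shows "rk ((truncation ^^ q) N) A = min (rk N A) (rank N - q)"
    and "rank ((truncation ^^ q) N) = rank N - q"
proof (induction q)
  case 0
  { case 1 show ?case using assms by simp }
  { case 2 show ?case by simp }
next
  case (Suc q)
  { case 1 show ?case using Suc by (simp add: truncation_def) }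
  { case 2 show ?case using Suc(2) by (simp add: truncation_def rank_def) }
qed

text \<open>The upward Moebius inverse of the indicator of \<open>rk M Y \<le> s\<close>. It is
  defined for all subsets, so that inversion takes place in the Boolean lattice instead of the
  lattice of flats.\<close>

definition trunc_coeff :: "'a rank_system \<Rightarrow> nat \<Rightarrow> 'a set \<Rightarrow> int" where
  "trunc_coeff M s X =
     (\<Sum>Y\<in>Pow (ground M). if X \<subseteq> Y \<and> rk M Y \<le> s then (-1) ^ card (Y - X) else 0)"

context matroid
begin

lemma finite_flats: "finite (flats M)"
  by (rule finite_subset[of _ "Pow (ground M)"]) (auto simp: flats_def finite_ground)

text \<open>Closure is monotone: for \<open>e\<close> outside \<open>Y\<close>, apply submodularity
  to \<open>Y\<close> and \<open>insert e X\<close>, which meet in \<open>X\<close>.\<close>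

lemma rk_insert_superset:
  assumes "X \<subseteq> Y" and "Y \<subseteq> ground M" and "e \<in> ground M" and "rk M (insert e X) \<le> rk M X"
  shows "rk M (insert e Y) = rk M Y"
proof (cases "e \<in> Y")
  case True
  then show ?thesis by (simp add: insert_absorb)
next
  case False
  then have eq: "Y \<union> insert e X = insert e Y" "Y \<inter> insert e X = X" using assms(1) by auto
  have "rk M (Y \<union> insert e X) + rk M (Y \<inter> insert e X) \<le> rk M Y + rk M (insert e X)"
    using assms by (intro rk_submodular) auto
  moreover have "rk M Y \<le> rk M (insert e Y)" using assms by (intro rk_mono) auto
  ultimately show ?thesis using assms(4) unfolding eq by linarith
qed

text \<open>Some \<open>e\<close> outside \<open>X\<close> lies in its closure. Toggling
  \<open>e\<close> in the sets \<open>Y\<close> above \<open>X\<close> preserves their rank and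
  flips the sign.\<close>

lemma trunc_coeff_not_flat:
  assumes "X \<subseteq> ground M" and "X \<notin> flats M"
  shows "trunc_coeff M s X = 0"
proof -
  obtain e where e: "e \<in> ground M" "e \<notin> X" "rk M (insert e X) \<le> rk M X"
    using assms by (auto simp: flats_def not_less)
  show ?thesis
    unfolding trunc_coeff_def
  proof (rule sum_Pow_eq_0_toggle[OF finite_ground e(1)])
    fix B assume B: "B \<subseteq> ground M - {e}"
    have "X \<subseteq> insert e B \<longleftrightarrow> X \<subseteq> B" using e(2) by auto
    moreover have "rk M (insert e B) = rk M B" if "X \<subseteq> B"
      using rk_insert_superset[OF that _ e(1,3)] B by auto
    moreover have "card (insert e B - X) = Suc (card (B - X))"
    proof -
      have "insert e B - X = insert e (B - X)" using e(2) by auto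
      moreover have "finite B" using B finite_ground finite_subset by blast
      ultimately show ?thesis using B by (subst card_insert_disjoint[symmetric]) auto
    qed
    ultimately show
      "(if X \<subseteq> insert e B \<and> rk M (insert e B) \<le> s then (-1) ^ card (insert e B - X) else (0::int)) =
       - (if X \<subseteq> B \<and> rk M B \<le> s then (-1) ^ card (B - X) else 0)"
      by auto
  qed
qed

lemma trunc_coeff_eq_0:
  assumes "s < rk M X"
  shows "trunc_coeff M s X = 0"
  unfolding trunc_coeff_def
proof (intro sum.neutral ballI)
  fix Y assume "Y \<in> Pow (ground M)"
  then have "rk M X \<le> rk M Y" if "X \<subseteq> Y" using that rk_mono by auto
  then show "(if X \<subseteq> Y \<and> rk M Y \<le> s then (-1) ^ card (Y - X) else (0::int)) = 0"
    using assms by auto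
qed

text \<open>Moebius inversion: after the sums are swapped, the inner sum over \<open>X\<close>
  between \<open>A\<close> and \<open>Y\<close> is a delta, which leaves only
  \<open>Y = A\<close>.\<close>

lemma sum_trunc_coeff:
  assumes "A \<subseteq> ground M"
  shows "(\<Sum>X\<in>Pow (ground M). if A \<subseteq> X then trunc_coeff M s X else 0) =
    (if rk M A \<le> s then 1 else 0)"
proof -
  let ?E = "ground M"
  have "(\<Sum>X\<in>Pow ?E. if A \<subseteq> X then trunc_coeff M s X else 0) =
    (\<Sum>X\<in>Pow ?E. \<Sum>Y\<in>Pow ?E.
       if A \<subseteq> X \<and> X \<subseteq> Y \<and> rk M Y \<le> s then (-1) ^ card (Y - X) else 0)"
    unfolding trunc_coeff_def by (auto intro!: sum.cong sum.neutral[symmetric])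
  also have "\<dots> = (\<Sum>Y\<in>Pow ?E. \<Sum>X\<in>Pow ?E.
       if A \<subseteq> X \<and> X \<subseteq> Y \<and> rk M Y \<le> s then (-1) ^ card (Y - X) else 0)"
    by (rule sum.swap)
  also have "\<dots> = (\<Sum>Y\<in>Pow ?E. if Y = A then if rk M A \<le> s then 1 else 0 else 0)"
  proof (rule sum.cong[OF refl])
    fix Y assume Y: "Y \<in> Pow ?E"
    have fin: "finite Y" using Y finite_ground finite_subset by blast
    have "(\<Sum>X\<in>Pow ?E. if A \<subseteq> X \<and> X \<subseteq> Y \<and> rk M Y \<le> s then (-1) ^ card (Y - X) else (0::int)) =
      (\<Sum>X\<in>Pow Y. if A \<subseteq> X \<and> X \<subseteq> Y \<and> rk M Y \<le> s then (-1) ^ card (Y - X) else 0)"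
      using Y finite_ground by (intro sum.mono_neutral_right) auto
    also have "\<dots> = (if rk M Y \<le> s then
        (\<Sum>X\<in>Pow Y. if A \<subseteq> X then (-1) ^ card (Y - X) else 0) else 0)"
      by (auto intro!: sum.cong sum.neutral)
    also have "\<dots> = (if Y = A then if rk M A \<le> s then 1 else 0 else 0)"
    proof (cases "A \<subseteq> Y")
      case True
      show ?thesis by (simp only: sum_interval_alternating[OF fin True]) simp
    next
      case False
      then have "\<not> A \<subseteq> X" if "X \<in> Pow Y" for X using that by blast
      moreover have "Y \<noteq> A" using False by auto
      ultimately show ?thesis by simp
    qed
    finally show "(\<Sum>X\<in>Pow ?E.
        if A \<subseteq> X \<and> X \<subseteq> Y \<and> rk M Y \<le> s then (-1) ^ card (Y - X) else (0::int)) =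
      (if Y = A then if rk M A \<le> s then 1 else 0 else 0)" .
  qed
  also have "\<dots> = (if rk M A \<le> s then 1 else 0)"
    using assms finite_ground by simp
  finally show ?thesis .
qed

text \<open>At \<open>x = 1\<close> only the spanning sets of the truncation survive, through
  \<open>0^0 = 1\<close>. The sign is written with a sum in the exponent to avoid truncated
  subtraction.\<close>

lemma moebius_inv_truncation_pow:
  assumes "q \<le> rank M"
  shows "moebius_inv ((truncation ^^ q) M) =
    (\<Sum>A\<in>Pow (ground M). if rank M - q \<le> rk M A then (-1) ^ (card A + (rank M - q)) else 0)"
  unfolding moebius_inv_def tutte_def ground_truncation_pow
proof (rule sum.cong[OF refl])
  fix A assume A: "A \<in> Pow (ground M)"
  then have rk: "rk M A \<le> rank M" "rk M A \<le> card A"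
    by (simp_all add: rk_le_rank rk_le_card)
  show "(1 - 1) ^ (rank ((truncation ^^ q) M) - rk ((truncation ^^ q) M) A) *
      (0 - 1) ^ (card A - rk ((truncation ^^ q) M) A) =
    (if rank M - q \<le> rk M A then (-1) ^ (card A + (rank M - q)) else (0::int))"
  proof (cases "rank M - q \<le> rk M A")
    case True
    then have "(-1) ^ (card A - (rank M - q)) = (-1::int) ^ (card A + (rank M - q))"
      using rk(2) by (intro neg_one_power_add_eq_neg_one_power_diff[symmetric]) simp
    then show ?thesis using True rk(1) by (simp add: rk_truncation_pow)
  next
    case False
    then show ?thesis using rk(1) by (simp add: rk_truncation_pow)
  qed
qed

text \<open>Over all subsets of the nonempty complement of \<open>X\<close> the signs cancel, so the
  spanning sets of the truncation may be traded for the nonspanning ones.\<close>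

lemma signed_moebius_eq_trunc_coeff:
  assumes X: "X \<subseteq> ground M" and k: "rk M X = k" and lt: "k + t < rank M"
  shows "(-1) ^ t * moebius_inv ((truncation ^^ (rank M - k - t - 1)) (contraction M X)) =
    trunc_coeff M (k + t) X"
proof -
  interpret N: matroid "contraction M X" by (rule matroid_contraction[OF X])
  let ?R = "ground M - X"
  have rank: "rank (contraction M X) = rank M - k" using rank_contraction[OF X] k by simp
  have mono: "k \<le> rk M (B \<union> X)" if "B \<subseteq> ?R" for B
    unfolding k[symmetric] using that X by (intro rk_mono) auto
  \<comment> \<open>\<open>X\<close> is not the whole ground set, as its rank \<open>k\<close> is
    below \<open>rank M\<close>.\<close>
  obtain e where e: "e \<in> ?R"
    using X k lt unfolding rank_def by (metis Diff_eq_empty_iff ex_in_conv le_add1 not_less subset_antisym)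
  have "(\<Sum>B\<in>Pow ?R. (-1) ^ card B) = (0::int)"
  proof (rule sum_Pow_eq_0_toggle[OF _ e])
    fix B assume B: "B \<subseteq> ?R - {e}"
    then have "finite B" "e \<notin> B" using finite_subset[OF _ finite_ground, of B] by auto
    then show "(-1) ^ card (insert e B) = - ((-1) ^ card B :: int)" by simp
  qed (simp add: finite_ground)
  then have cancel: "(\<Sum>B\<in>Pow ?R. if rk M (B \<union> X) \<le> k + t then (-1) ^ card B else (0::int)) =
      - (\<Sum>B\<in>Pow ?R. if rk M (B \<union> X) \<le> k + t then 0 else (-1) ^ card B)"
    unfolding eq_neg_iff_add_eq_0 sum.distrib[symmetric] by (simp add: if_distrib cong: if_cong)
  have "moebius_inv ((truncation ^^ (rank M - k - t - 1)) (contraction M X)) =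
    (\<Sum>B\<in>Pow ?R. if t + 1 \<le> rk M (B \<union> X) - k then (-1) ^ (card B + (t + 1)) else 0)"
  proof -
    have diff: "rank M - k - (rank M - k - t - 1) = t + 1" using lt by auto
    show ?thesis
      using N.moebius_inv_truncation_pow[of "rank M - k - t - 1"] unfolding rank diff
      by (simp add: contraction_def k)
  qed
  also have "\<dots> = (\<Sum>B\<in>Pow ?R. (-1) ^ (t + 1) * (if rk M (B \<union> X) \<le> k + t then 0 else (-1) ^ card B))"
  proof (rule sum.cong[OF refl])
    fix B assume "B \<in> Pow ?R"
    then have "t + 1 \<le> rk M (B \<union> X) - k \<longleftrightarrow> \<not> rk M (B \<union> X) \<le> k + t"
      using mono[of B] by auto
    then show "(if t + 1 \<le> rk M (B \<union> X) - k then (-1) ^ (card B + (t + 1)) else 0) =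
      (-1) ^ (t + 1) * (if rk M (B \<union> X) \<le> k + t then 0 else (-1::int) ^ card B)"
      by (simp add: power_add)
  qed
  \<comment> \<open>Passing to the nonspanning sets costs one sign. The remaining
    \<open>(-1)^t\<close> cancels against the same factor in the statement.\<close>
  also have "\<dots> = (-1) ^ t * (\<Sum>B\<in>Pow ?R. if rk M (B \<union> X) \<le> k + t then (-1) ^ card B else 0)"
    unfolding cancel sum_distrib_left[symmetric] by simp
  also have "(\<Sum>B\<in>Pow ?R. if rk M (B \<union> X) \<le> k + t then (-1) ^ card B else 0) =
    (\<Sum>Y\<in>{Y\<in>Pow (ground M). X \<subseteq> Y}. if rk M Y \<le> k + t then (-1::int) ^ card (Y - X) else 0)"
  proof (rule sum.reindex_bij_witness[where i = "\<lambda>Y. Y - X" and j = "\<lambda>B. B \<union> X"])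
    fix B assume "B \<in> Pow ?R"
    moreover from this have "B \<union> X - X = B" by auto
    ultimately show "(if rk M (B \<union> X) \<le> k + t then (-1) ^ card (B \<union> X - X) else 0) =
      (if rk M (B \<union> X) \<le> k + t then (-1::int) ^ card B else 0)" by simp
  qed (use X in auto)
  also have "\<dots> = trunc_coeff M (k + t) X"
    unfolding trunc_coeff_def using finite_ground
    by (intro sum.mono_neutral_cong_left) auto
  finally show ?thesis by (simp add: mult.assoc[symmetric] power_add[symmetric])
qed

text \<open>The sign built into the flat number is absorbed, so \<open>k\<close> and
  \<open>t\<close> enter each coefficient only through the level \<open>s = k + t\<close>.\<close>

lemma flat_number_eq:
  assumes "k + t < rank M"
  shows "flat_number M t k m =
    (\<Sum>X | X \<in> flats M \<and> rk M X = k \<and> card X = m. trunc_coeff M (k + t) X)"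
  unfolding flat_number_def sum_distrib_left
  using assms by (intro sum.cong signed_moebius_eq_trunc_coeff) (auto simp: flats_def)

section \<open>Comparison with the uniform matroid\<close>

text \<open>Uniform rank depends only on size, so a bijection of ground sets puts both Tutte
  polynomials over the same index set, ready for termwise subtraction.\<close>

lemma tutte_uniform_eq:
  "tutte (uniform (rank M) (card (ground M))) x y =
    (\<Sum>A\<in>Pow (ground M). (x - 1) ^ (rank M - min (card A) (rank M)) *
       (y - 1) ^ (card A - min (card A) (rank M)))"
proof -
  let ?n = "card (ground M)"
  obtain f where f: "bij_betw f {..<?n} (ground M)"
    using ex_bij_betw_nat_finite[OF finite_ground] by (auto simp: lessThan_atLeast0)
  have rank: "rank (uniform (rank M) ?n) = rank M"
    by (rule rank_uniform) (simp add: rank_def rk_le_card)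
  have card: "card (f ` A) = card A" if "A \<subseteq> {..<?n}" for A
    using that f by (meson bij_betw_imp_inj_on card_image inj_on_subset)
  show ?thesis
    unfolding tutte_def rank
    by (subst sum.reindex_bij_betw[OF bij_betw_Pow[OF f], symmetric]) (simp add: uniform_def card)
qed

lemma tutte_diff_uniform:
  fixes x y :: "'b::comm_ring_1"
  shows "tutte M x y - tutte (uniform (rank M) (card (ground M))) x y =
    (x * y - x - y) * (\<Sum>s<rank M. (x - 1) ^ (rank M - 1 - s) *
       (\<Sum>A\<in>Pow (ground M). if rk M A \<le> s then large_weight s y A else 0))"
proof -
  let ?r = "rank M"
  let ?u = "x - 1" and ?v = "y - 1"
  \<comment> \<open>This is \<open>xy - x - y = uv - 1\<close>, shaped for the telescoping step with
    \<open>p\<close>, \<open>q\<close> as the lowered powers of \<open>u\<close>,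
    \<open>v\<close>.\<close>
  have ring: "(x * y - x - y) * (p * q) = - (p * q - ?u * p * (?v * q))" for p q :: 'b
    by (simp add: algebra_simps)
  have summand: "?u ^ (?r - rk M A) * ?v ^ (card A - rk M A) -
      ?u ^ (?r - min (card A) ?r) * ?v ^ (card A - min (card A) ?r) =
    (x * y - x - y) * (\<Sum>s<?r. if rk M A \<le> s then ?u ^ (?r - 1 - s) * large_weight s y A else 0)"
    if "A \<in> Pow (ground M)" for A
  proof -
    let ?p = "min (card A) ?r" and ?j = "rk M A"
    have j: "?j \<le> ?p" using that by (simp add: rk_le_rank rk_le_card)
    \<comment> \<open>\<open>c\<close> interpolates between the two summands of \<open>A\<close>: at
      \<open>s = ?j\<close> it is that of \<open>M\<close>, at \<open>s = ?p\<close> that of the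
      uniform matroid.\<close>
    define c where "c = (\<lambda>s. ?u ^ (?r - s) * ?v ^ (card A - s))"
    have "(x * y - x - y) * (\<Sum>s<?r. if ?j \<le> s then ?u ^ (?r - 1 - s) * large_weight s y A else 0) =
      (x * y - x - y) * (\<Sum>s\<in>{?j..<?p}. ?u ^ (?r - 1 - s) * ?v ^ (card A - 1 - s))"
      unfolding large_weight_def
      by (intro arg_cong2[where f = "(*)"] refl sum.mono_neutral_cong_right) auto
    also have "\<dots> = (\<Sum>s\<in>{?j..<?p}. - (c (Suc s) - c s))"
      unfolding sum_distrib_left
    proof (rule sum.cong[OF refl])
      fix s assume s: "s \<in> {?j..<?p}"
      then have eqs: "?r - s = Suc (?r - 1 - s)" "card A - s = Suc (card A - 1 - s)"
        "?r - Suc s = ?r - 1 - s" "card A - Suc s = card A - 1 - s" by auto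
      show "(x * y - x - y) * (?u ^ (?r - 1 - s) * ?v ^ (card A - 1 - s)) = - (c (Suc s) - c s)"
        unfolding c_def eqs power_Suc by (rule ring)
    qed
    also have "\<dots> = c ?j - c ?p"
      unfolding sum_negf sum_Suc_diff'[OF j] by simp
    finally show ?thesis by (simp add: c_def)
  qed
  have "tutte M x y - tutte (uniform ?r (card (ground M))) x y =
    (\<Sum>A\<in>Pow (ground M). (x * y - x - y) *
      (\<Sum>s<?r. if rk M A \<le> s then ?u ^ (?r - 1 - s) * large_weight s y A else 0))"
    unfolding tutte_uniform_eq unfolding tutte_def sum_subtractf[symmetric]
    using summand by (rule sum.cong[OF refl])
  also have "\<dots> = (x * y - x - y) * (\<Sum>s<?r. \<Sum>A\<in>Pow (ground M).
      if rk M A \<le> s then ?u ^ (?r - 1 - s) * large_weight s y A else 0)"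
    unfolding sum_distrib_left[symmetric] by (subst sum.swap) (rule refl)
  also have "(\<Sum>s<?r. \<Sum>A\<in>Pow (ground M).
      if rk M A \<le> s then ?u ^ (?r - 1 - s) * large_weight s y A else 0) =
    (\<Sum>s<?r. ?u ^ (?r - 1 - s) * (\<Sum>A\<in>Pow (ground M). if rk M A \<le> s then large_weight s y A else 0))"
    unfolding sum_distrib_left by (intro sum.cong refl) simp
  finally show ?thesis .
qed

section \<open>Assembling the sum over flat numbers\<close>

text \<open>Expand \<open>tau\<close> over the subsets \<open>A\<close> of \<open>X\<close> and
  swap: the coefficients of all \<open>X\<close> above \<open>A\<close> add up to the indicator of
  \<open>rk M A \<le> s\<close>.\<close>

lemma sum_trunc_coeff_tau:
  "(\<Sum>X\<in>Pow (ground M). of_int (trunc_coeff M s X) *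
      tau (int s + 1) (int (card X) - int s - 1) y) =
    (\<Sum>A\<in>Pow (ground M). if rk M A \<le> s then large_weight s y A else 0)"
proof -
  let ?E = "ground M"
  have "(\<Sum>X\<in>Pow ?E. of_int (trunc_coeff M s X) * tau (int s + 1) (int (card X) - int s - 1) y) =
    (\<Sum>X\<in>Pow ?E. \<Sum>A\<in>Pow ?E. if A \<subseteq> X then of_int (trunc_coeff M s X) * large_weight s y A else 0)"
  proof (rule sum.cong[OF refl])
    fix X assume X: "X \<in> Pow ?E"
    then have "finite X" using finite_ground finite_subset by auto
    then have "of_int (trunc_coeff M s X) * tau (int s + 1) (int (card X) - int s - 1) y =
      (\<Sum>A\<in>Pow X. of_int (trunc_coeff M s X) * large_weight s y A)"
      by (simp add: tau_eq_sum_large_weight sum_distrib_left)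
    also have "\<dots> = (\<Sum>A\<in>Pow ?E.
        if A \<subseteq> X then of_int (trunc_coeff M s X) * large_weight s y A else 0)"
      using X finite_ground by (intro sum.mono_neutral_cong_left) auto
    finally show "of_int (trunc_coeff M s X) * tau (int s + 1) (int (card X) - int s - 1) y = \<dots>" .
  qed
  also have "\<dots> = (\<Sum>A\<in>Pow ?E. \<Sum>X\<in>Pow ?E.
      if A \<subseteq> X then of_int (trunc_coeff M s X) * large_weight s y A else 0)"
    by (rule sum.swap)
  also have "\<dots> = (\<Sum>A\<in>Pow ?E. of_int (\<Sum>X\<in>Pow ?E. if A \<subseteq> X then trunc_coeff M s X else 0) *
      large_weight s y A)"
    unfolding of_int_sum sum_distrib_right by (intro sum.cong refl) simp
  also have "\<dots> = (\<Sum>A\<in>Pow ?E. if rk M A \<le> s then large_weight s y A else 0)"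
    by (intro sum.cong refl) (simp add: sum_trunc_coeff)
  finally show ?thesis .
qed

text \<open>Substituting \<open>s = k + t\<close> and merging the classes of equal rank and size
  leaves one sum over flats of rank 1 to \<open>r - 1\<close>. Extending it to all subsets adds only
  zeros.\<close>

lemma sum_flat_numbers:
  fixes x y :: "'b::comm_ring_1"
  assumes "loopless M" and "rank M = r" and "r \<ge> 1" and n: "card (ground M) = n"
  shows "(\<Sum>k=1..r-1. \<Sum>m=k..n. \<Sum>t=0..r-k-1.
       of_int (flat_number M t k m) * (x - 1) ^ (r - k - t - 1) *
       tau (int k + 1 + int t) (int m - int k - int t - 1) y) =
    (\<Sum>s<r. (x - 1) ^ (r - 1 - s) * (\<Sum>X\<in>Pow (ground M).
       of_int (trunc_coeff M s X) * tau (int s + 1) (int (card X) - int s - 1) y))"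
proof -
  define h where "h = (\<lambda>s X. of_int (trunc_coeff M s X) * (x - 1) ^ (r - 1 - s) *
    tau (int s + 1) (int (card X) - int s - 1) y)"
  define H where "H = (\<lambda>X. \<Sum>s<r. h s X)"
  let ?F = "\<lambda>k. {X \<in> flats M. rk M X = k}"
  have inner: "(\<Sum>t=0..r-k-1. of_int (flat_number M t k m) * (x - 1) ^ (r - k - t - 1) *
       tau (int k + 1 + int t) (int m - int k - int t - 1) y) =
    sum H {X \<in> ?F k. card X = m}" if k: "k \<in> {1..r-1}" for k m
  proof -
    have "(\<Sum>t=0..r-k-1. of_int (flat_number M t k m) * (x - 1) ^ (r - k - t - 1) *
       tau (int k + 1 + int t) (int m - int k - int t - 1) y) =
      (\<Sum>t=0..r-k-1. \<Sum>X\<in>{X \<in> ?F k. card X = m}. h (k + t) X)"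
    proof (rule sum.cong[OF refl])
      fix t assume "t \<in> {0..r-k-1}"
      then have lt: "k + t < rank M" and e: "r - k - t - 1 = r - 1 - (k + t)"
        using k assms(2) by auto
      have a: "int k + 1 + int t = int (k + t) + 1"
        "int m - int k - int t - 1 = int m - int (k + t) - 1" by auto
      have S: "{X. X \<in> flats M \<and> rk M X = k \<and> card X = m} = {X \<in> ?F k. card X = m}" by auto
      show "of_int (flat_number M t k m) * (x - 1) ^ (r - k - t - 1) *
         tau (int k + 1 + int t) (int m - int k - int t - 1) y =
        (\<Sum>X\<in>{X \<in> ?F k. card X = m}. h (k + t) X)"
        unfolding flat_number_eq[OF lt] S e a of_int_sum sum_distrib_right h_def
        by (intro sum.cong refl) simp
    qed
    also have "\<dots> = (\<Sum>X\<in>{X \<in> ?F k. card X = m}. \<Sum>t=0..r-k-1. h (k + t) X)"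
      by (rule sum.swap)
    also have "\<dots> = sum H {X \<in> ?F k. card X = m}"
    proof (rule sum.cong[OF refl])
      fix X assume X: "X \<in> {X \<in> ?F k. card X = m}"
      have "(\<Sum>t=0..r-k-1. h (k + t) X) = (\<Sum>s\<in>{k..<r}. h s X)"
        using k by (intro sum.reindex_bij_witness[where i = "\<lambda>s. s - k" and j = "\<lambda>t. k + t"]) auto
      \<comment> \<open>The levels \<open>s < k\<close> may be added, since no set above
        \<open>X\<close> has rank at most \<open>s\<close>.\<close>
      also have "\<dots> = H X"
        unfolding H_def h_def using X trunc_coeff_eq_0[of _ X]
        by (intro sum.mono_neutral_left) auto
      finally show "(\<Sum>t=0..r-k-1. h (k + t) X) = H X" .
    qed
    finally show ?thesis .
  qed
  \<comment> \<open>Every flat of rank \<open>k\<close> has a size in the range of \<open>m\<close>,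
    so grouping by size loses nothing.\<close>
  have F: "finite (?F k)" "card ` ?F k \<subseteq> {k..n}" for k
  proof -
    show "finite (?F k)" using finite_flats by simp
    show "card ` ?F k \<subseteq> {k..n}"
      unfolding n[symmetric] using rk_le_card card_mono[OF finite_ground] by (auto simp: flats_def)
  qed
  have H0: "H X = 0" if "X \<in> Pow (ground M)" "X \<notin> flats M \<or> rk M X \<notin> {1..r-1}" for X
  proof -
    have "h s X = 0" if "s < r" for s
    proof -
      consider "X \<notin> flats M" | "rk M X = 0" | "rk M X \<ge> r"
        using \<open>X \<notin> flats M \<or> rk M X \<notin> {1..r-1}\<close> assms(3) by fastforce
      then show ?thesis
      proof cases
        case 1
        then show ?thesis
          using \<open>X \<in> Pow (ground M)\<close> by (simp add: h_def trunc_coeff_not_flat)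
      next
        case 2
        \<comment> \<open>Looplessness leaves only the empty set in rank 0. There the second
          parameter of \<open>tau\<close> is \<open>-s - 1\<close>, so \<open>tau\<close> takes its
          default value 0.\<close>
        have "X = {}"
        proof (rule ccontr)
          assume "X \<noteq> {}"
          then obtain e where "e \<in> X" by auto
          then have "rk M {e} \<le> rk M X" "e \<in> ground M"
            using \<open>X \<in> Pow (ground M)\<close> by (auto intro: rk_mono)
          then show False using 2 assms(1) by (auto simp: loopless_def)
        qed
        then show ?thesis by (simp add: h_def tau_def)
      next
        case 3
        then show ?thesis using that by (simp add: h_def trunc_coeff_eq_0)
      qed
    qed
    then show ?thesis by (simp add: H_def)
  qed
  let ?G = "{X \<in> flats M. rk M X \<in> {1..r-1}}"
  have "(\<Sum>k=1..r-1. \<Sum>m=k..n. \<Sum>t=0..r-k-1.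
       of_int (flat_number M t k m) * (x - 1) ^ (r - k - t - 1) *
       tau (int k + 1 + int t) (int m - int k - int t - 1) y) =
    (\<Sum>k=1..r-1. \<Sum>m=k..n. sum H {X \<in> ?F k. card X = m})"
    using inner by (intro sum.cong refl)
  also have "\<dots> = (\<Sum>k=1..r-1. sum H (?F k))"
    using F by (intro sum.cong refl sum.group) auto
  also have "\<dots> = (\<Sum>k=1..r-1. sum H {X \<in> ?G. rk M X = k})"
    by (intro sum.cong refl) auto
  also have "\<dots> = sum H ?G"
    using finite_flats by (intro sum.group) auto
  also have "\<dots> = sum H (Pow (ground M))"
    using H0 finite_ground by (intro sum.mono_neutral_left) (auto simp: flats_def)
  also have "\<dots> = (\<Sum>s<r. \<Sum>X\<in>Pow (ground M). h s X)"
    unfolding H_def by (rule sum.swap)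
  also have "\<dots> = (\<Sum>s<r. (x - 1) ^ (r - 1 - s) * (\<Sum>X\<in>Pow (ground M).
       of_int (trunc_coeff M s X) * tau (int s + 1) (int (card X) - int s - 1) y))"
    unfolding sum_distrib_left h_def by (intro sum.cong refl) (simp add: mult_ac)
  finally show ?thesis .
qed

end

theorem mainTheorem3:
  fixes M :: "'a rank_system" and r n :: nat and x y :: "'b::comm_ring_1"
  assumes "matroid M" and "loopless M"
    and "rank M = r" and "r \<ge> 1" and "card (ground M) = n"
  shows "tutte M x y = tutte (uniform r n) x y +
    (x * y - x - y) *
    (\<Sum>k=1..r-1. \<Sum>m=k..n. \<Sum>t=0..r-k-1.
       of_int (flat_number M t k m) * (x - 1) ^ (r - k - t - 1) *
       tau (int k + 1 + int t) (int m - int k - int t - 1) y)"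
proof -
  interpret matroid M by fact
  have "tutte M x y - tutte (uniform r n) x y = (x * y - x - y) *
    (\<Sum>k=1..r-1. \<Sum>m=k..n. \<Sum>t=0..r-k-1.
       of_int (flat_number M t k m) * (x - 1) ^ (r - k - t - 1) *
       tau (int k + 1 + int t) (int m - int k - int t - 1) y)"
    unfolding sum_flat_numbers[OF assms(2-5)] sum_trunc_coeff_tau
    using tutte_diff_uniform[of x y] assms(3,5) by simp
  then show ?thesis by (simp add: diff_eq_eq add.commute)
qed

end
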